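(* (i) No Lucas number is divisible by $5$; hence the Lucas sequence is itself a 5-free Fibonacci sequence in which no division ever takes place, and its terms grow indefinitely. (ii) The 5-free Fibonacci sequence that starts with $0, 1$ ends in a cycle, i.e. it is eventually periodic.
   Context: The Lucas sequence is $L_0=2$, $L_1=1$, $L_{k}=L_{k-1}+L_{k-2}$. A 5-free Fibonacci sequence is a sequence starting with two nonnegative integers, not both zero, in which each later term is the sum of the previous two terms divided by the largest power of $5$ (possibly $5^0=1$) dividing that sum. *)

theory Defs
  imports Complex_Main "HOL-Computational_Algebra.Primes"
begin

fun lucas :: "nat \<Rightarrow> nat" where
  "lucas 0 = 2"
| "lucas (Suc 0) = 1"
| "lucas (Suc (Suc n)) = lucas (Suc n) + lucas n"

text \<open>The largest power of 5 dividing \<open>m\<close>. Since \<open>multiplicity 5 0 = 0\<close>, the value at 0 is 1;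
  this case never occurs in a sequence whose first two terms are not both zero.\<close>

definition five_power_part :: "nat \<Rightarrow> nat" where
  "five_power_part m = 5 ^ multiplicity 5 m"

definition five_free_fib_seq :: "(nat \<Rightarrow> nat) \<Rightarrow> bool" where
  "five_free_fib_seq s \<longleftrightarrow>
     \<not> (s 0 = 0 \<and> s 1 = 0) \<and>
     (\<forall>n. s (n + 2) = (s n + s (n + 1)) div five_power_part (s n + s (n + 1)))"

fun five_free_fib :: "nat \<Rightarrow> nat \<Rightarrow> nat \<Rightarrow> nat" where
  "five_free_fib a b 0 = a"
| "five_free_fib a b (Suc 0) = b"
| "five_free_fib a b (Suc (Suc n)) =
     (five_free_fib a b n + five_free_fib a b (Suc n)) div
       five_power_part (five_free_fib a b n + five_free_fib a b (Suc n))"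

lemma five_free_fib_seq_iff:
  assumes "\<not> (a = 0 \<and> b = 0)"
  shows "five_free_fib_seq s \<and> s 0 = a \<and> s 1 = b \<longleftrightarrow> s = five_free_fib a b"
proof
  assume s: "five_free_fib_seq s \<and> s 0 = a \<and> s 1 = b"
  have "s n = five_free_fib a b n" for n
    using s by (induction a b n rule: five_free_fib.induct) (auto simp: five_free_fib_seq_def)
  then show "s = five_free_fib a b" ..
next
  assume "s = five_free_fib a b"
  then show "five_free_fib_seq s \<and> s 0 = a \<and> s 1 = b"
    using assms by (auto simp: five_free_fib_seq_def)
qed

definition eventually_periodic :: "(nat \<Rightarrow> 'a) \<Rightarrow> bool" where
  "eventually_periodic s \<longleftrightarrow> (\<exists>N p. p > 0 \<and> (\<forall>n\<ge>N. s (n + p) = s n))"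

end

theory Submission
  imports Defs
begin

text \<open>
  Modulo 5 the Lucas sequence repeats the pattern 2, 1, 3, 4, which avoids 0
  (\<open>lucas_mod_5\<close>). Hence the sums that produce its terms never contain a factor 5, and no
  division slows down the growth of the Fibonacci recurrence.

  Started at 0, 1, by contrast, the 5-free sequence runs 0, 1, 1, 2, 3, 1, 4, 1, 1, \<open>\<dots>\<close>:
  the sums 2 + 3, 1 + 4 and 4 + 1 all collapse to 1, and the pair (1, 1) at the indices 1, 2
  returns at the indices 7, 8 (\<open>five_free_fib_0_1_pair_recurs\<close>). As a term depends only on the
  two before it, everything from index 1 on repeats with period 6
  (\<open>eventually_periodic_if_pair_recurs\<close>).
\<close>

text \<open>The residues 2, 1, 3, 4 must be carried along together: two consecutive ones determine
  the next, so a statement about a single residue is not inductive.\<close>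

lemma lucas_mod_5:
  "(lucas n mod 5, lucas (Suc n) mod 5) \<in> {(2, 1), (1, 3), (3, 4), (4, 2)}"
proof (induction n)
  case 0
  show ?case by simp
next
  case (Suc n)
  have "lucas (Suc (Suc n)) mod 5 = (lucas (Suc n) mod 5 + lucas n mod 5) mod 5"
    by (simp add: mod_add_eq)
  with Suc show ?case by auto
qed

lemma not_5_dvd_lucas: "\<not> 5 dvd lucas n"
  using lucas_mod_5[of n] by (auto simp: dvd_eq_mod_eq_0)

lemma five_power_part_eq_1: "\<not> 5 dvd m \<Longrightarrow> five_power_part m = 1"
  by (simp add: five_power_part_def not_dvd_imp_multiplicity_0)

lemma five_power_part_lucas_sum: "five_power_part (lucas n + lucas (n + 1)) = 1"
proof -
  have "lucas n + lucas (n + 1) = lucas (Suc (Suc n))" by simp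
  then show ?thesis
    by (metis five_power_part_eq_1 not_5_dvd_lucas)
qed

lemma five_free_fib_seq_lucas: "five_free_fib_seq lucas"
  unfolding five_free_fib_seq_def
  by (simp only: five_power_part_lucas_sum) simp

lemma lucas_ge: "n \<le> lucas n"
proof (induction n rule: lucas.induct)
  case (3 n)
  \<comment> \<open>Positivity is supplied by indivisibility, as 5 divides 0.\<close>
  have "lucas n > 0"
    using not_5_dvd_lucas[of n] by (cases "lucas n") auto
  with 3 show ?case by simp
qed auto

lemma filterlim_lucas: "filterlim lucas at_top sequentially"
  by (rule filterlim_at_top_mono[OF filterlim_ident]) (simp add: lucas_ge)

lemma eventually_periodic_if_pair_recurs:
  assumes rec: "\<And>n. s (Suc (Suc n)) = f (s n) (s (Suc n))"
    and "p > 0" and "s (N + p) = s N" and "s (Suc N + p) = s (Suc N)"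
  shows "eventually_periodic s"
proof -
  have "s (N + k + p) = s (N + k) \<and> s (Suc (N + k) + p) = s (Suc (N + k))" for k
    by (induction k) (use assms in auto)
  then have "\<forall>n\<ge>N. s (n + p) = s n"
    by (metis le_Suc_ex)
  with \<open>p > 0\<close> show ?thesis
    unfolding eventually_periodic_def by blast
qed

lemma five_power_part_5: "five_power_part 5 = 5"
  by (simp add: five_power_part_def)

lemma five_free_fib_0_1_pair_recurs:
  defines "s \<equiv> five_free_fib 0 1"
  shows "s (1 + 6) = s 1" and "s (Suc 1 + 6) = s (Suc 1)"
proof -
  have rec: "s (Suc (Suc n)) = (s n + s (Suc n)) div five_power_part (s n + s (Suc n))" for n
    by (simp add: s_def)
  have undivided: "s k = c" if "k = Suc m" "m = Suc n" "s n + s m = c" "\<not> 5 dvd c" for k m n c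
    using that rec[of n] five_power_part_eq_1[of c] by simp
  have divided: "s k = 1" if "k = Suc m" "m = Suc n" "s n + s m = 5" for k m n
    using that rec[of n] by (simp add: five_power_part_5)
  have s0: "s 0 = 0" and s1: "s 1 = 1"
    by (simp_all add: s_def)
  have s2: "s 2 = 1"
    by (rule undivided[of 2 1 0]) (use s0 s1 in simp_all)
  have s3: "s 3 = 2"
    by (rule undivided[of 3 2 1]) (use s1 s2 in simp_all)
  have s4: "s 4 = 3"
    by (rule undivided[of 4 3 2]) (use s2 s3 in simp_all)
  have s5: "s 5 = 1"
    by (rule divided[of 5 4 3]) (use s3 s4 in simp_all)
  have s6: "s 6 = 4"
    by (rule undivided[of 6 5 4]) (use s4 s5 in simp_all)
  have s7: "s 7 = 1"
    by (rule divided[of 7 6 5]) (use s5 s6 in simp_all)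
  have s8: "s 8 = 1"
    by (rule divided[of 8 7 6]) (use s6 s7 in simp_all)
  show "s (1 + 6) = s 1"
    using s1 s7 by simp
  show "s (Suc 1 + 6) = s (Suc 1)"
    using s2 s8 by (simp add: numeral_2_eq_2)
qed

theorem mainTheorem15:
  shows "((\<forall>n. \<not> 5 dvd lucas n) \<and>
          five_free_fib_seq lucas \<and>
          (\<forall>n. five_power_part (lucas n + lucas (n + 1)) = 1) \<and>
          filterlim lucas at_top sequentially) \<and>
         eventually_periodic (five_free_fib 0 1)"
proof (intro conjI allI)
  show "eventually_periodic (five_free_fib 0 1)"
  proof (rule eventually_periodic_if_pair_recurs[where N = 1 and p = 6])
    show "five_free_fib 0 1 (Suc (Suc n)) =
        (\<lambda>x y. (x + y) div five_power_part (x + y)) (five_free_fib 0 1 n) (five_free_fib 0 1 (Suc n))"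
      for n by simp
  qed (fact five_free_fib_0_1_pair_recurs | simp)+
qed (fact not_5_dvd_lucas five_free_fib_seq_lucas five_power_part_lucas_sum filterlim_lucas)+

end
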